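(* For every $A\in C_{s+2}(2n)$ the assignment $[0,1]\ni t\mapsto\beta_t(A)=\mathrm{e}^{(t\pi/2)KJ(A)}\cdot E_{+\mathrm{i}}(K)$ is a curve in $C_{s+1}(2n)$ with initial point $\beta_0(A)=E_{+\mathrm{i}}(K)$, final point $\beta_1(A)=E_{-\mathrm{i}}(K)$ and midpoint $\beta_{1/2}(A)=A$. It is $\mathbb{Z}_2$-equivariant in the sense that $\beta_t(A)^\perp=\beta_{1-t}(A^\perp)$ for all $t\in[0,1]$.
   Context: Let $s\ge0$. $W=\mathbb{C}^{2n}$ carries a Hermitian scalar product $\langle\cdot,\cdot\rangle$ and a non-degenerate symmetric complex bilinear form $\{\cdot,\cdot\}$, related by $\langle\psi,\psi'\rangle=\{\gamma\psi,\psi'\}$ for a complex anti-linear involution $\gamma$ of $W$; $j_1,\dots,j_s$ are $\mathbb{C}$-linear operators on $W$ preserving both forms with $j_lj_m+j_mj_l=-2\delta_{lm}\mathrm{Id}$. $\mathbb{C}^2\otimes W=W\oplus W$ carries the orthogonal-sum Hermitian product and bilinear form. For a complex subspace $A\subset\mathbb{C}^2\otimes W$, $A^{\mathrm c}$ is the Hermitian orthogonal complement and $A^\perp$ the annihilator of $A$ w.r.t. $\{\cdot,\cdot\}$. Put $$J_l=\begin{pmatrix}0&1\\1&0\end{pmatrix}\otimes j_l\ (1\le l\le s),\quad I=\begin{pmatrix}0&1\\-1&0\end{pmatrix}\otimes\mathrm{Id}_W,\quad K=\begin{pmatrix}\mathrm{i}&0\\0&-\mathrm{i}\end{pmatrix}\otimes\mathrm{Id}_W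 .$$ These $s+2$ unitary operators pairwise anti-commute and square to $-\mathrm{Id}$; $J_1,\dots,J_s,I$ preserve $\{\cdot,\cdot\}$, while $\{Kw,Kw'\}=-\{w,w'\}$. $C_{s+1}(2n)$ is the space of complex subspaces $A\subset\mathbb{C}^2\otimes W$ with $J_1A=\dots=J_sA=IA=A^{\mathrm c}$, and $C_{s+2}(2n)=\{A\in C_{s+1}(2n)\mid KA=A^{\mathrm c}\}$. $E_{\pm\mathrm{i}}(K)$ are the eigenspaces of $K$, and $J(A)=\mathrm{i}(\Pi_A-\Pi_{A^{\mathrm c}})$, where $\Pi_A,\Pi_{A^{\mathrm c}}$ are the orthogonal projectors onto $A,A^{\mathrm c}$. *)

theory Defs
  imports "HOL-Analysis.Analysis"
begin

text \<open>
  The tensor product of the complex plane with \<open>W = complex ^ 'm\<close> is identified with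
  \<open>W \<oplus> W\<close>, i.e. with the type \<open>W \<times> W\<close>; a 2-by-2 matrix tensored with an operator on \<open>W\<close>
  becomes the corresponding block operator. The complex scaling on \<open>W \<times> W\<close> is \<open>dbl.scale\<close>.
\<close>

type_synonym 'm cvec = "complex ^ 'm"
type_synonym 'm dvec = "(complex ^ 'm) \<times> (complex ^ 'm)"

interpretation dbl: finite_dimensional_vector_space_prod
  "(*s) :: complex \<Rightarrow> complex ^ 'm \<Rightarrow> complex ^ 'm"
  "(*s) :: complex \<Rightarrow> complex ^ 'm \<Rightarrow> complex ^ 'm"
  cart_basis cart_basis
  ..

section \<open>Structures on \<open>W\<close>\<close>

text \<open>The Hermitian product is conjugate-linear in its first argument.\<close>

definition hermitian_product :: "('m::finite cvec \<Rightarrow> 'm cvec \<Rightarrow> complex) \<Rightarrow> bool" where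
  "hermitian_product herm \<longleftrightarrow>
     (\<forall>u v w. herm u (v + w) = herm u v + herm u w) \<and>
     (\<forall>c u v. herm u (c *s v) = c * herm u v) \<and>
     (\<forall>u v. herm v u = cnj (herm u v)) \<and>
     (\<forall>u. u \<noteq> 0 \<longrightarrow> Re (herm u u) > 0)"

definition nondegenerate_symmetric_bilinear_form ::
    "('m::finite cvec \<Rightarrow> 'm cvec \<Rightarrow> complex) \<Rightarrow> bool" where
  "nondegenerate_symmetric_bilinear_form bil \<longleftrightarrow>
     (\<forall>u v w. bil u (v + w) = bil u v + bil u w) \<and>
     (\<forall>c u v. bil u (c *s v) = c * bil u v) \<and>
     (\<forall>u v. bil v u = bil u v) \<and>
     (\<forall>u. (\<forall>v. bil u v = 0) \<longrightarrow> u = 0)"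

definition antilinear_involution :: "('m::finite cvec \<Rightarrow> 'm cvec) \<Rightarrow> bool" where
  "antilinear_involution \<gamma> \<longleftrightarrow>
     (\<forall>u v. \<gamma> (u + v) = \<gamma> u + \<gamma> v) \<and>
     (\<forall>c u. \<gamma> (c *s u) = cnj c *s \<gamma> u) \<and>
     (\<forall>u. \<gamma> (\<gamma> u) = u)"

definition preserves_form ::
    "('v \<Rightarrow> 'v \<Rightarrow> complex) \<Rightarrow> ('v \<Rightarrow> 'v) \<Rightarrow> bool" where
  "preserves_form f T \<longleftrightarrow> (\<forall>u v. f (T u) (T v) = f u v)"

definition clifford_generators :: "nat \<Rightarrow> (nat \<Rightarrow> 'm::finite cvec \<Rightarrow> 'm cvec) \<Rightarrow> bool" where
  "clifford_generators s j \<longleftrightarrow>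
     (\<forall>l\<in>{1..s}. Vector_Spaces.linear (*s) (*s) (j l)) \<and>
     (\<forall>l\<in>{1..s}. \<forall>m\<in>{1..s}. \<forall>w.
        j l (j m w) + j m (j l w) = (if l = m then - 2 else 0) *s w)"

section \<open>The doubled space\<close>

definition sum_form ::
    "('m::finite cvec \<Rightarrow> 'm cvec \<Rightarrow> complex) \<Rightarrow> 'm dvec \<Rightarrow> 'm dvec \<Rightarrow> complex" where
  "sum_form f x y = f (fst x) (fst y) + f (snd x) (snd y)"

text \<open>
  Applied to the Hermitian product this is the orthogonal complement, applied to the bilinear
  form it is the annihilator; both forms are (conjugate-)symmetric, so the side is irrelevant.
\<close>

definition complement_wrt ::
    "('m::finite cvec \<Rightarrow> 'm cvec \<Rightarrow> complex) \<Rightarrow> 'm dvec set \<Rightarrow> 'm dvec set" where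
  "complement_wrt f A = {x. \<forall>a\<in>A. sum_form f a x = 0}"

definition op_J :: "(nat \<Rightarrow> 'm::finite cvec \<Rightarrow> 'm cvec) \<Rightarrow> nat \<Rightarrow> 'm dvec \<Rightarrow> 'm dvec" where
  "op_J j l x = (j l (snd x), j l (fst x))"

definition op_I :: "'m::finite dvec \<Rightarrow> 'm dvec" where
  "op_I x = (snd x, - fst x)"

definition op_K :: "'m::finite dvec \<Rightarrow> 'm dvec" where
  "op_K x = (\<i> *s fst x, (- \<i>) *s snd x)"

definition eigenspace :: "('m::finite dvec \<Rightarrow> 'm dvec) \<Rightarrow> complex \<Rightarrow> 'm dvec set" where
  "eigenspace T c = {x. T x = dbl.scale c x}"

definition C_first ::
    "('m::finite cvec \<Rightarrow> 'm cvec \<Rightarrow> complex) \<Rightarrow> nat \<Rightarrow> (nat \<Rightarrow> 'm cvec \<Rightarrow> 'm cvec)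
      \<Rightarrow> 'm dvec set set" where \<comment> \<open>\<open>C\<^bsub>s+1\<^esub>(2n)\<close>\<close>
  "C_first herm s j =
     {A. dbl.p.subspace A \<and>
         (\<forall>l\<in>{1..s}. op_J j l ` A = complement_wrt herm A) \<and>
         op_I ` A = complement_wrt herm A}"

definition C_second ::
    "('m::finite cvec \<Rightarrow> 'm cvec \<Rightarrow> complex) \<Rightarrow> nat \<Rightarrow> (nat \<Rightarrow> 'm cvec \<Rightarrow> 'm cvec)
      \<Rightarrow> 'm dvec set set" where \<comment> \<open>\<open>C\<^bsub>s+2\<^esub>(2n)\<close>\<close>
  "C_second herm s j = {A \<in> C_first herm s j. op_K ` A = complement_wrt herm A}"

definition orth_proj ::
    "('m::finite cvec \<Rightarrow> 'm cvec \<Rightarrow> complex) \<Rightarrow> 'm dvec set \<Rightarrow> 'm dvec \<Rightarrow> 'm dvec" where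
  "orth_proj herm A x = (THE a. a \<in> A \<and> x - a \<in> complement_wrt herm A)"

definition J_of ::
    "('m::finite cvec \<Rightarrow> 'm cvec \<Rightarrow> complex) \<Rightarrow> 'm dvec set \<Rightarrow> 'm dvec \<Rightarrow> 'm dvec" where
  "J_of herm A x = dbl.scale \<i> (orth_proj herm A x - orth_proj herm (complement_wrt herm A) x)"

text \<open>
  The operator exponential as its power series. On a finite-dimensional space, pointwise
  summation agrees with summation in operator norm.
\<close>

definition op_exp :: "('v::real_normed_vector \<Rightarrow> 'v) \<Rightarrow> 'v \<Rightarrow> 'v" where
  "op_exp T x = (\<Sum>k. (T ^^ k) x /\<^sub>R fact k)"

definition beta ::
    "('m::finite cvec \<Rightarrow> 'm cvec \<Rightarrow> complex) \<Rightarrow> real \<Rightarrow> 'm dvec set \<Rightarrow> 'm dvec set" where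
  "beta herm t A =
     op_exp (\<lambda>x. (t * pi / 2) *\<^sub>R op_K (J_of herm A x)) ` eigenspace op_K \<i>"

text \<open>
  The usual topology on the set of all complex subspaces (the disjoint union of the
  Grassmannians): the one induced by embedding \<open>A\<close> as its orthogonal projector into the
  space of operators with the norm topology.
\<close>

definition subspace_topology ::
    "('m::finite cvec \<Rightarrow> 'm cvec \<Rightarrow> complex) \<Rightarrow> 'm dvec set topology" where
  "subspace_topology herm =
     pullback_topology {A. dbl.p.subspace A} (\<lambda>A. Blinfun (orth_proj herm A)) euclidean"

end

(* An element A of C_{s+1} is determined by the skew-Hermitian complex structure J(A), which squares
   to -1 and has A as its +i eigenspace. For A in C_{s+2}, J = J(A) anticommutes with K, so KJ squares
   to -1 and R_a = exp(a KJ) = cos a + sin a KJ satisfies (cos 2a K + sin 2a J) R_a = R_a K. Hence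
   beta_t(A) is the +i eigenspace of L_t = cos(pi t) K + sin(pi t) J, with projector (1 - i L_t)/2.
   At t = 0, 1/2, 1 the structure L_t is K, J, -K; every J_l and I anticommutes with K and J, hence
   with L_t, and therefore swaps the two eigenspaces of L_t. If C is the antilinear involution
   gamma on both summands, the annihilator of the +i eigenspace of L is the +i eigenspace of CLC;
   since CKC = -K, the structure C L_t C is the L_{1-t} of the annihilator of A. *)

theory Submission
  imports Defs
begin

section \<open>Complex-linear maps on \<open>W \<times> W\<close> and their eigenspaces\<close>

abbreviation cscale :: "complex \<Rightarrow> 'm::finite dvec \<Rightarrow> 'm dvec" (infixr "\<cdot>" 75) where
  "c \<cdot> x \<equiv> dbl.scale c x"

abbreviation clinear :: "('m::finite dvec \<Rightarrow> 'm dvec) \<Rightarrow> bool" where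
  "clinear \<equiv> Vector_Spaces.linear dbl.scale dbl.scale"

lemma clinear_iff:
  "clinear T \<longleftrightarrow> (\<forall>x y. T (x + y) = T x + T y) \<and> (\<forall>c x. T (c \<cdot> x) = c \<cdot> T x)"
  by (simp add: Vector_Spaces.linear_iff dbl.p.vector_space_axioms)

lemma scaleR_dvec: "r *\<^sub>R x = complex_of_real r \<cdot> x"
  unfolding prod_eq_iff vec_eq_iff dbl.scale_def
  by (simp only: fst_scaleR snd_scaleR vector_scaleR_component vector_smult_component
      scaleR_conv_of_real[where 'a = complex] fst_conv snd_conv simp_thms)

lemma cscale_i_i [simp]: "\<i> \<cdot> \<i> \<cdot> x = - x"
  by simp

lemma cscale_scaleR: "c \<cdot> (r *\<^sub>R x) = r *\<^sub>R (c \<cdot> x)"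
  by (simp add: scaleR_dvec mult.commute)

lemmas cscale_simps =
  dbl.p.scale_right_distrib dbl.p.scale_right_diff_distrib cscale_scaleR

lemma clinearD:
  assumes "clinear T"
  shows "T (x + y) = T x + T y" "T (c \<cdot> x) = c \<cdot> T x" "T (r *\<^sub>R x) = r *\<^sub>R T x"
    "T (- x) = - T x" "T (x - y) = T x - T y" "T 0 = 0"
proof -
  show 1: "T (x + y) = T x + T y" and 2: "T (c \<cdot> x) = c \<cdot> T x" for x y c
    using assms unfolding clinear_iff by blast+
  show "T (r *\<^sub>R x) = r *\<^sub>R T x"
    by (simp add: scaleR_dvec 2)
  show 3: "T (- x) = - T x" for x
    using 2[of "-1" x] by simp
  show "T (x - y) = T x - T y"
    using 1[of x "- y"] 3 by simp
  show "T 0 = 0"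
    using 2[of 0 0] by simp
qed

lemma clinear_imp_bounded_linear:
  assumes "clinear T"
  shows "bounded_linear T"
  unfolding linear_conv_bounded_linear[symmetric]
  by (rule linearI) (simp_all add: clinearD[OF assms])

lemma subspace_eigenspace: "clinear T \<Longrightarrow> dbl.p.subspace (eigenspace T c)"
  by (auto simp: dbl.p.subspace_def eigenspace_def clinearD dbl.p.scale_right_distrib mult.commute)

text \<open>If \<open>L x = c \<cdot> x\<close>, then
  \<open>L (T x) = - T (L x) = (- c) \<cdot> T x\<close>. Since \<open>- T\<close> inverts
  \<open>T\<close>, the same computation for \<open>- T\<close> gives surjectivity.\<close>

lemma image_eigenspace_anticommuting:
  assumes T: "clinear T" "\<And>x. T (T x) = - x"
    and anti: "\<And>x. L (T x) = - T (L x)"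
    and L: "clinear L"
  shows "T ` eigenspace L c = eigenspace L (- c)"
proof
  show "T ` eigenspace L c \<subseteq> eigenspace L (- c)"
    by (auto simp: eigenspace_def anti clinearD[OF T(1)])
  show "eigenspace L (- c) \<subseteq> T ` eigenspace L c"
  proof
    fix y assume "y \<in> eigenspace L (- c)"
    then have "- T y \<in> eigenspace L c"
      by (simp add: eigenspace_def anti clinearD[OF T(1)] clinearD[OF L])
    moreover have "y = T (- T y)"
      by (simp add: clinearD[OF T(1)] T(2))
    ultimately show "y \<in> T ` eigenspace L c"
      by blast
  qed
qed

text \<open>For a Hermitian product these are the unitary complex structures: skewness and square
  \<open>-1\<close> together give \<open>h (L x) (L y) = h x y\<close>. They will turn out to be
  exactly the operators \<open>J_of herm A\<close>.\<close>

definition skew_structure ::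
    "('m::finite cvec \<Rightarrow> 'm cvec \<Rightarrow> complex) \<Rightarrow> ('m dvec \<Rightarrow> 'm dvec) \<Rightarrow> bool" where
  "skew_structure herm L \<longleftrightarrow> clinear L \<and> (\<forall>x. L (L x) = - x) \<and>
     (\<forall>x y. sum_form herm (L x) y = - sum_form herm x (L y))"

section \<open>The operators \<open>K\<close>, \<open>I\<close>, \<open>J_l\<close>: squares and
  anticommutation with \<open>K\<close>\<close>

lemma op_K_clinear: "clinear op_K"
  by (simp add: clinear_iff op_K_def dbl.scale_def vec_eq_iff prod_eq_iff algebra_simps)

lemma op_K_square: "op_K (op_K x) = - x"
  by (simp add: op_K_def vec_eq_iff prod_eq_iff)

lemma op_I_clinear: "clinear op_I"
  by (simp add: clinear_iff op_I_def dbl.scale_def vec_eq_iff prod_eq_iff algebra_simps)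

lemma op_I_square: "op_I (op_I x) = - x"
  by (simp add: op_I_def prod_eq_iff)

lemma op_K_op_I: "op_K (op_I x) = - op_I (op_K x)"
  by (simp add: op_I_def op_K_def vec_eq_iff prod_eq_iff)

context
  fixes s :: nat and j :: "nat \<Rightarrow> 'm::finite cvec \<Rightarrow> 'm cvec" and l :: nat
  assumes j: "clifford_generators s j" and l: "l \<in> {1..s}"
begin

lemma generator_linear: "j l (x + y) = j l x + j l y" "j l (c *s x) = c *s j l x"
  using j l by (auto simp: clifford_generators_def Vector_Spaces.linear_iff)

lemma generator_minus: "j l (- x) = - j l x"
  using generator_linear(2)[of "-1" x] by (simp flip: vector_sneg_minus1)

lemma generator_square: "j l (j l w) = - w"
proof -
  have "j l (j l w) + j l (j l w) = (- 2) *s w"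
    using j l unfolding clifford_generators_def by presburger
  then have "2 *s j l (j l w) = 2 *s (- w)"
    by (simp add: vec_eq_iff)
  then show ?thesis
    by (simp add: vec_eq_iff)
qed

lemma op_J_clinear: "clinear (op_J j l)"
  by (simp add: clinear_iff op_J_def dbl.scale_def generator_linear)

lemma op_J_square: "op_J j l (op_J j l x) = - x"
  by (simp add: op_J_def generator_square prod_eq_iff)

lemma op_K_op_J: "op_K (op_J j l x) = - op_J j l (op_K x)"
  by (simp add: op_J_def op_K_def generator_linear(2) generator_minus prod_eq_iff)

end

section \<open>Orthogonal complements and projectors for an arbitrary Hermitian product\<close>

locale hermitian_double =
  fixes herm :: "'m::finite cvec \<Rightarrow> 'm cvec \<Rightarrow> complex"
  assumes herm: "hermitian_product herm"
begin

abbreviation h :: "'m dvec \<Rightarrow> 'm dvec \<Rightarrow> complex" where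
  "h \<equiv> sum_form herm"

abbreviation ortho :: "'m dvec set \<Rightarrow> 'm dvec set" where
  "ortho \<equiv> complement_wrt herm"

lemma herm_cnj: "herm v u = cnj (herm u v)"
  and herm_add_right: "herm u (v + w) = herm u v + herm u w"
  and herm_scale_right: "herm u (c *s v) = c * herm u v"
  and herm_pos: "u \<noteq> 0 \<Longrightarrow> Re (herm u u) > 0"
  using herm unfolding hermitian_product_def by blast+

lemma h_cnj: "h y x = cnj (h x y)"
  unfolding sum_form_def complex_cnj_add by (simp only: herm_cnj[symmetric])

lemma h_add_right: "h x (y + z) = h x y + h x z"
  by (simp add: sum_form_def herm_add_right)

lemma h_scale_right: "h x (c \<cdot> y) = c * h x y"
  by (simp add: sum_form_def herm_scale_right dbl.scale_def distrib_left)

lemma h_add_left: "h (y + z) x = h y x + h z x"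
  by (metis h_cnj h_add_right complex_cnj_add)

lemma h_scale_left: "h (c \<cdot> y) x = cnj c * h y x"
  by (metis h_cnj h_scale_right complex_cnj_mult)

lemma h_minus_right: "h x (- y) = - h x y"
  using h_scale_right[of x "-1" y] by simp

lemma h_minus_left: "h (- x) y = - h x y"
  using h_scale_left[of "-1" x y] by simp

lemma h_diff_right: "h x (y - z) = h x y - h x z"
  using h_add_right[of x y "- z"] by (simp add: h_minus_right)

lemma h_diff_left: "h (y - z) x = h y x - h z x"
  using h_add_left[of y "- z" x] by (simp add: h_minus_left)

lemma h_scaleR: "h x (r *\<^sub>R y) = of_real r * h x y" "h (r *\<^sub>R x) y = of_real r * h x y"
  by (simp_all add: scaleR_dvec h_scale_right h_scale_left)

lemma h_zero_right: "h x 0 = 0"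
  using h_scale_right[of x 0 0] by simp

lemmas h_simps = h_add_right h_add_left h_scale_right h_scale_left h_minus_right h_minus_left
  h_diff_right h_diff_left h_scaleR h_zero_right

lemma h_self_eq_0: "h x x = 0 \<longleftrightarrow> x = 0"
proof -
  have z: "herm 0 0 = 0"
    using herm_scale_right[of 0 0 0] by simp
  have pos: "Re (herm u u) \<ge> 0" "Re (herm u u) = 0 \<longleftrightarrow> u = 0" for u
    using herm_pos[of u] z by (cases "u = 0"; simp)+
  have "x = 0" if "h x x = 0"
  proof -
    have "Re (herm (fst x) (fst x)) + Re (herm (snd x) (snd x)) = 0"
      using that by (metis plus_complex.sel(1) sum_form_def zero_complex.sel(1))
    then have "Re (herm (fst x) (fst x)) = 0" "Re (herm (snd x) (snd x)) = 0"
      using pos(1)[of "fst x"] pos(1)[of "snd x"] by linarith+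
    then show "x = 0"
      by (simp add: pos(2) prod_eq_iff)
  qed
  then show ?thesis
    by (auto simp: h_zero_right)
qed

lemma subspace_ortho: "dbl.p.subspace (ortho A)"
  by (auto simp: dbl.p.subspace_def complement_wrt_def h_simps)

text \<open>Gram-Schmidt, as an induction over a finite spanning set of \<open>A\<close>.\<close>

lemma orthogonal_decomposition:
  assumes "dbl.p.subspace A"
  shows "\<exists>a\<in>A. x - a \<in> ortho A"
proof -
  have *: "\<exists>a\<in>dbl.p.span B. x - a \<in> ortho (dbl.p.span B)" if "finite B" for B
    using that
  proof (induction B arbitrary: x)
    case empty
    then show ?case by (simp add: complement_wrt_def h_simps h_cnj[of 0])
  next
    case (insert b B)
    obtain p where p: "p \<in> dbl.p.span B" "b - p \<in> ortho (dbl.p.span B)"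
      using insert.IH by blast
    obtain a where a: "a \<in> dbl.p.span B" "x - a \<in> ortho (dbl.p.span B)"
      using insert.IH by blast
    \<comment> \<open>\<open>q\<close> is the part of \<open>b\<close> orthogonal to
      \<open>span B\<close>, and \<open>k\<close> is the coefficient of \<open>x - a\<close> along
      \<open>q\<close>. If \<open>b\<close> already lies in \<open>span B\<close>, then
      \<open>q = 0\<close>, and division by zero makes \<open>k = 0\<close>, leaving
      \<open>a\<close> unchanged.\<close>
    define q where "q = b - p"
    define k where "k = h q (x - a) / h q q"
    define a' where "a' = a + k \<cdot> q"
    have q: "q \<in> dbl.p.span (insert b B)"
      unfolding q_def using p(1)
      by (meson dbl.p.span_base dbl.p.span_diff dbl.p.span_mono insertI1 subset_insertI subsetD)
    have "a' \<in> dbl.p.span (insert b B)"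
      unfolding a'_def using q a(1)
      by (meson dbl.p.span_add dbl.p.span_scale dbl.p.span_mono subset_insertI subsetD)
    moreover have "x - a' \<in> ortho (dbl.p.span (insert b B))"
      unfolding complement_wrt_def
    proof (safe)
      fix v assume "v \<in> dbl.p.span (insert b B)"
      then obtain c where c: "v - c \<cdot> b \<in> dbl.p.span B"
        by (auto simp: dbl.p.span_breakdown_eq)
      \<comment> \<open>Substituting \<open>b = p + q\<close> and absorbing \<open>p\<close> into
        \<open>span B\<close> leaves orthogonality to be tested on \<open>span B\<close> and on
        \<open>q\<close> only.\<close>
      define u where "u = v - c \<cdot> b + c \<cdot> p"
      have u: "u \<in> dbl.p.span B"
        unfolding u_def using c p(1) by (meson dbl.p.span_add dbl.p.span_scale)
      have v: "v = u + c \<cdot> q"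
        by (simp add: u_def q_def cscale_simps)
      have "h u (x - a) = 0" "h u q = 0"
        using u a(2) p(2) by (auto simp: complement_wrt_def q_def)
      then have "h u (x - a') = 0"
        by (simp add: a'_def h_simps)
      moreover have "h q (x - a') = 0"
      proof (cases "q = 0")
        case True
        then show ?thesis
          using h_scale_left[of 0 0] by simp
      next
        case False
        then have "h q q \<noteq> 0"
          by (simp add: h_self_eq_0)
        then have "k * h q q = h q (x - a)"
          by (simp add: k_def)
        moreover have "h q (x - a') = h q (x - a) - k * h q q"
          by (simp add: a'_def h_simps)
        ultimately show ?thesis
          by simp
      qed
      ultimately show "h v (x - a') = 0"
        by (simp add: v h_add_left h_scale_left)
    qed
    ultimately show ?case
      by blast
  qed
  obtain B where B: "B \<subseteq> A" "dbl.p.independent B" "A \<subseteq> dbl.p.span B"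
    by (rule dbl.p.basis_exists[of A])
  have "dbl.p.span B = A"
    using B(3) dbl.p.span_minimal[OF B(1) assms] by (rule subset_antisym[rotated])
  moreover have "finite B"
    by (rule dbl.p.finiteI_independent[OF B(2)])
  ultimately show ?thesis
    using *[of B] by simp
qed

text \<open>Two candidates differ by an element of \<open>A\<close>, which is orthogonal to both
  residuals. The residuals differ by that same element, so it is orthogonal to itself and
  vanishes.\<close>

lemma orth_proj_eqI:
  assumes A: "dbl.p.subspace A" and a: "a \<in> A" "x - a \<in> ortho A"
  shows "orth_proj herm A x = a"
  unfolding orth_proj_def
proof (rule the_equality)
  fix b assume b: "b \<in> A \<and> x - b \<in> ortho A"
  have "a - b \<in> A"
    using A a b dbl.p.subspace_diff by blast
  then have "h (a - b) (x - b) = 0" "h (a - b) (x - a) = 0"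
    using a b by (auto simp: complement_wrt_def)
  then have "h (a - b) ((x - b) - (x - a)) = 0"
    unfolding h_diff_right[of "a - b" "x - b"] by simp
  then show "b = a"
    by (simp add: h_self_eq_0)
qed (use a in blast)

lemma subset_ortho_ortho: "A \<subseteq> ortho (ortho A)"
  by (auto simp: complement_wrt_def) (metis complex_cnj_zero h_cnj)

section \<open>Eigenspaces of a skew structure\<close>

context
  fixes L :: "'m dvec \<Rightarrow> 'm dvec"
  assumes L: "skew_structure herm L"
begin

lemma skew_clinear: "clinear L" and skew_square: "L (L x) = - x"
  and skew_skew: "h (L x) y = - h x (L y)"
  using L unfolding skew_structure_def by blast+

lemmas skew_simps = clinearD[OF skew_clinear] skew_square

text \<open>As \<open>L\<close> squares to \<open>-1\<close>, the vectors
  \<open>x - \<i> \<cdot> L x\<close> and \<open>x + \<i> \<cdot> L x\<close> are twice the spectral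
  components of \<open>x\<close>.\<close>

lemma eigenspace_plusI: "x - \<i> \<cdot> L x \<in> eigenspace L \<i>"
  by (simp add: eigenspace_def skew_simps cscale_simps algebra_simps)

lemma eigenspace_minusI: "x + \<i> \<cdot> L x \<in> eigenspace L (- \<i>)"
  by (simp add: eigenspace_def skew_simps cscale_simps algebra_simps)

lemma ortho_eigenspace: "ortho (eigenspace L \<i>) = eigenspace L (- \<i>)"
proof
  have orth: "h a x = 0" if "a \<in> eigenspace L \<i>" "x \<in> eigenspace L (- \<i>)" for a x
  proof -
    have "L a = \<i> \<cdot> a" "L x = (- \<i>) \<cdot> x"
      using that by (auto simp: eigenspace_def)
    \<comment> \<open>On the left \<open>\<i>\<close> comes out conjugated; on the right the sign of
      the eigenvalue cancels the sign from skewness.\<close>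
    then have "- \<i> * h a x = \<i> * h a x"
      using skew_skew[of a x] by (simp add: h_simps)
    then show ?thesis
      by simp
  qed
  then show "eigenspace L (- \<i>) \<subseteq> ortho (eigenspace L \<i>)"
    by (auto simp: complement_wrt_def)
  show "ortho (eigenspace L \<i>) \<subseteq> eigenspace L (- \<i>)"
  proof
    fix x assume x: "x \<in> ortho (eigenspace L \<i>)"
    define y where "y = x - \<i> \<cdot> L x"
    have y: "y \<in> eigenspace L \<i>"
      unfolding y_def by (rule eigenspace_plusI)
    have "h y x = 0"
      using x y by (auto simp: complement_wrt_def)
    moreover have "h y (x + \<i> \<cdot> L x) = 0"
      using y orth eigenspace_minusI by blast
    \<comment> \<open>Twice the \<open>\<i>\<close>-component \<open>y\<close> is orthogonal to
      \<open>x\<close> and to the other component, hence to itself. Its vanishing leaves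
      \<open>x\<close> in the \<open>- \<i>\<close> eigenspace.\<close>
    moreover have "y = x + x - (x + \<i> \<cdot> L x)"
      by (simp add: y_def)
    ultimately have "h y y = 0"
      by (metis h_add_right h_diff_right add_0 diff_0_right)
    then have "\<i> \<cdot> x = - L x"
      using cscale_i_i[of "L x"] by (simp add: h_self_eq_0 y_def del: cscale_i_i)
    then show "x \<in> eigenspace L (- \<i>)"
      by (simp add: eigenspace_def)
  qed
qed

text \<open>The two spectral components add up to \<open>x\<close> and lie in mutually orthogonal
  eigenspaces. The resulting projector is affine in \<open>L\<close>, which later yields continuity
  of the path.\<close>

lemma orth_proj_eigenspace:
  "orth_proj herm (eigenspace L \<i>) x = (1 / 2) *\<^sub>R (x - \<i> \<cdot> L x)"
proof (rule orth_proj_eqI)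
  show "dbl.p.subspace (eigenspace L \<i>)"
    by (rule subspace_eigenspace[OF skew_clinear])
  show "(1 / 2) *\<^sub>R (x - \<i> \<cdot> L x) \<in> eigenspace L \<i>"
    using eigenspace_plusI by (simp add: eigenspace_def clinearD[OF skew_clinear] cscale_simps)
  have "x - (1 / 2) *\<^sub>R (x - \<i> \<cdot> L x) = (1 / 2) *\<^sub>R (x + \<i> \<cdot> L x)"
    by (simp add: algebra_simps flip: scaleR_left_distrib)
  then show "x - (1 / 2) *\<^sub>R (x - \<i> \<cdot> L x) \<in> ortho (eigenspace L \<i>)"
    unfolding ortho_eigenspace
    using eigenspace_minusI[of x]
    by (simp only: eigenspace_def mem_Collect_eq clinearD(3)[OF skew_clinear] cscale_scaleR)
qed

end

section \<open>The structure \<open>J(A)\<close> of a subspace\<close>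

context
  fixes A :: "'m dvec set"
  assumes A: "dbl.p.subspace A"
begin

lemma orth_proj_in: "orth_proj herm A x \<in> A" "x - orth_proj herm A x \<in> ortho A"
  using orthogonal_decomposition[OF A, of x] orth_proj_eqI[OF A, of _ x] by blast+

lemma orth_proj_ortho: "orth_proj herm (ortho A) x = x - orth_proj herm A x"
  using orth_proj_in[of x] subset_ortho_ortho
  by (intro orth_proj_eqI) (auto simp: subspace_ortho)

lemma J_of_eq: "J_of herm A x = \<i> \<cdot> (orth_proj herm A x - (x - orth_proj herm A x))"
  by (simp add: J_of_def orth_proj_ortho)

lemma J_of_add: "a \<in> A \<Longrightarrow> b \<in> ortho A \<Longrightarrow> J_of herm A (a + b) = \<i> \<cdot> a - \<i> \<cdot> b"
  by (simp add: J_of_eq orth_proj_eqI[OF A, of a] cscale_simps)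

lemma ortho_decompE:
  obtains a b where "a \<in> A" "b \<in> ortho A" "x = a + b"
  using orth_proj_in[of x] by (metis add_diff_cancel_left' diff_add_cancel add.commute)

text \<open>Everything is checked on components along \<open>A\<close> and \<open>ortho A\<close>,
  where \<open>J_of herm A\<close> is multiplication by \<open>\<i>\<close> and by
  \<open>- \<i>\<close>.\<close>

lemma J_of_skew: "skew_structure herm (J_of herm A)"
  unfolding skew_structure_def clinear_iff
proof (intro conjI allI)
  fix x y :: "'m dvec" and c
  obtain a b where x: "a \<in> A" "b \<in> ortho A" "x = a + b"
    by (rule ortho_decompE)
  obtain a' b' where y: "a' \<in> A" "b' \<in> ortho A" "y = a' + b'"
    by (rule ortho_decompE)
  note closed = dbl.p.subspace_add[OF A] dbl.p.subspace_scale[OF A] dbl.p.subspace_neg[OF A]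
    dbl.p.subspace_add[OF subspace_ortho] dbl.p.subspace_scale[OF subspace_ortho]
    dbl.p.subspace_neg[OF subspace_ortho]
  have "x + y = (a + a') + (b + b')"
    by (simp add: x y)
  then show "J_of herm A (x + y) = J_of herm A x + J_of herm A y"
    using x y J_of_add[of a b] J_of_add[of a' b'] J_of_add[of "a + a'" "b + b'"]
    by (simp only: closed) (simp add: cscale_simps)
  have "c \<cdot> x = c \<cdot> a + c \<cdot> b"
    by (simp add: x cscale_simps)
  then show "J_of herm A (c \<cdot> x) = c \<cdot> J_of herm A x"
    using x J_of_add by (simp add: closed cscale_simps mult.commute)
  have "J_of herm A (\<i> \<cdot> a + (- \<i> \<cdot> b)) = \<i> \<cdot> \<i> \<cdot> a - \<i> \<cdot> (- \<i> \<cdot> b)"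
    using x by (intro J_of_add) (simp_all only: closed)
  then show "J_of herm A (J_of herm A x) = - x"
    using x J_of_add by simp
  have "h a b' = 0" "h b a' = 0"
    using x y h_cnj[of a' b] by (auto simp: complement_wrt_def)
  then show "h (J_of herm A x) y = - h x (J_of herm A y)"
    using x y J_of_add by (simp add: h_simps)
qed

text \<open>Together with \<open>J_of_eigenspace\<close> this makes subspaces and skew structures
  correspond bijectively.\<close>

lemma eigenspace_J_of: "eigenspace (J_of herm A) \<i> = A"
proof
  have half: "v = 0" if "\<i> \<cdot> v = - (\<i> \<cdot> v)" for v :: "'m dvec"
  proof -
    have "\<i> \<cdot> \<i> \<cdot> v = - (\<i> \<cdot> \<i> \<cdot> v)"
      using that by (metis dbl.p.scale_minus_right)
    then show ?thesis
      by (simp add: prod_eq_iff vec_eq_iff)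
  qed
  show "eigenspace (J_of herm A) \<i> \<subseteq> A"
  proof
    fix x assume x: "x \<in> eigenspace (J_of herm A) \<i>"
    obtain a b where ab: "a \<in> A" "b \<in> ortho A" "x = a + b"
      by (rule ortho_decompE)
    \<comment> \<open>Compare \<open>\<i> \<cdot> a - \<i> \<cdot> b\<close>, the value of
      \<open>J_of herm A x\<close>, with \<open>\<i> \<cdot> (a + b)\<close>.\<close>
    then have "\<i> \<cdot> b = - (\<i> \<cdot> b)"
      using x by (simp add: eigenspace_def J_of_add cscale_simps)
    then have "b = 0"
      by (rule half)
    then show "x \<in> A"
      using ab by simp
  qed
  show "A \<subseteq> eigenspace (J_of herm A) \<i>"
    using J_of_add[of _ 0] by (auto simp: eigenspace_def dbl.p.subspace_0[OF subspace_ortho])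
qed

text \<open>Because \<open>T\<close> squares to \<open>-1\<close>, it also maps
  \<open>ortho A\<close> back into \<open>A\<close>. So it exchanges the two eigenspaces of
  \<open>J_of herm A\<close>, and with them the eigenvalues \<open>\<i>\<close> and
  \<open>- \<i>\<close>.\<close>

lemma anticommute_J_of:
  assumes T: "clinear T" "\<And>x. T (T x) = - x" and img: "T ` A = ortho A"
  shows "J_of herm A (T x) = - T (J_of herm A x)"
proof -
  obtain a b where x: "a \<in> A" "b \<in> ortho A" "x = a + b"
    by (rule ortho_decompE)
  have "T a \<in> ortho A"
    using x img by blast
  moreover have "T b \<in> A"
    using x img T(2) dbl.p.subspace_neg[OF A] by (metis image_iff)
  moreover have "T x = T b + T a"
    using x clinearD[OF T(1)] by simp
  ultimately have "J_of herm A (T x) = \<i> \<cdot> T b - \<i> \<cdot> T a"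
    by (simp only: J_of_add)
  then show ?thesis
    using x by (simp add: J_of_add clinearD[OF T(1)])
qed

end

text \<open>For the projector \<open>P\<close> onto the eigenspace,
  \<open>2 P - 1 = - \<i> L\<close>; multiplying by \<open>\<i>\<close> recovers
  \<open>L\<close>.\<close>

lemma J_of_eigenspace:
  assumes "skew_structure herm L"
  shows "J_of herm (eigenspace L \<i>) = L"
proof
  fix x
  have "J_of herm (eigenspace L \<i>) x = \<i> \<cdot> (- (\<i> \<cdot> L x))"
    using subspace_eigenspace[of L] skew_clinear[OF assms]
    by (simp add: J_of_eq orth_proj_eigenspace[OF assms] algebra_simps flip: scaleR_left_distrib)
  then show "J_of herm (eigenspace L \<i>) x = L x"
    by simp
qed

lemma op_K_skew: "skew_structure herm op_K"
proof -
  have "herm (c *s u) v = cnj c * herm u v" for c u v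
    by (metis complex_cnj_mult herm_cnj herm_scale_right)
  moreover have "herm (- u) v = - herm u v" "herm u (- v) = - herm u v" for u v
    using calculation[of "-1" u v] herm_scale_right[of u "-1" v]
    by (simp_all flip: vector_sneg_minus1)
  ultimately show ?thesis
    by (simp add: herm_scale_right skew_structure_def op_K_clinear op_K_square sum_form_def op_K_def)
qed

text \<open>Anticommutation cancels the cross terms in the square, which leaves
  \<open>- (c\<^sup>2 + s\<^sup>2)\<close>.\<close>

lemma skew_combination:
  assumes L: "skew_structure herm L" and M: "skew_structure herm M"
    and anti: "\<And>x. L (M x) = - M (L x)"
    and cs: "c\<^sup>2 + s\<^sup>2 = (1 :: real)"
  shows "skew_structure herm (\<lambda>x. c *\<^sub>R L x + s *\<^sub>R M x)"
  unfolding skew_structure_def clinear_iff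
proof (intro conjI allI)
  note lin = clinearD[OF skew_clinear[OF L]] clinearD[OF skew_clinear[OF M]]
  fix x y and k
  show "c *\<^sub>R L (x + y) + s *\<^sub>R M (x + y) = (c *\<^sub>R L x + s *\<^sub>R M x) + (c *\<^sub>R L y + s *\<^sub>R M y)"
    by (simp add: lin algebra_simps)
  show "c *\<^sub>R L (k \<cdot> x) + s *\<^sub>R M (k \<cdot> x) = k \<cdot> (c *\<^sub>R L x + s *\<^sub>R M x)"
    by (simp add: lin cscale_simps)
  have "c *\<^sub>R L (c *\<^sub>R L x + s *\<^sub>R M x) + s *\<^sub>R M (c *\<^sub>R L x + s *\<^sub>R M x) = - ((c\<^sup>2 + s\<^sup>2) *\<^sub>R x)"
    by (simp add: lin anti skew_square[OF L] skew_square[OF M] power2_eq_square algebra_simps)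
  then show "c *\<^sub>R L (c *\<^sub>R L x + s *\<^sub>R M x) + s *\<^sub>R M (c *\<^sub>R L x + s *\<^sub>R M x) = - x"
    by (simp add: cs)
  show "h (c *\<^sub>R L x + s *\<^sub>R M x) y = - h x (c *\<^sub>R L y + s *\<^sub>R M y)"
    by (simp add: h_simps skew_skew[OF L] skew_skew[OF M])
qed

end

section \<open>The exponential and the path of structures \<open>L_t\<close>\<close>

text \<open>Euler's formula with \<open>N\<close> as imaginary unit: even powers assemble to the
  cosine series, odd powers to the sine series.\<close>

lemma op_exp_square_minus_id:
  fixes N :: "'v::real_normed_vector \<Rightarrow> 'v"
  assumes scale: "\<And>r x. N (r *\<^sub>R x) = r *\<^sub>R N x" and square: "\<And>x. N (N x) = - x"
  shows "op_exp (\<lambda>x. t *\<^sub>R N x) x = cos t *\<^sub>R x + sin t *\<^sub>R N x"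
proof -
  define T where "T = (\<lambda>x. t *\<^sub>R N x)"
  have even: "(T ^^ (2 * m)) x = ((- 1) ^ m * t ^ (2 * m)) *\<^sub>R x" for m
    by (induction m) (simp_all add: T_def scale square algebra_simps)
  \<comment> \<open>\<open>cos_coeff\<close> vanishes at odd and \<open>sin_coeff\<close> at even
    indices, so each index contributes to one series only.\<close>
  have summand: "(T ^^ k) x /\<^sub>R fact k =
      (cos_coeff k *\<^sub>R t ^ k) *\<^sub>R x + (sin_coeff k *\<^sub>R t ^ k) *\<^sub>R N x" for k
  proof (cases "even k")
    case True
    then obtain m where "k = 2 * m"
      by (elim evenE)
    then show ?thesis
      using even[of m] by (simp add: cos_coeff_def sin_coeff_def divide_inverse_commute mult_ac)
  next
    case False
    then obtain m where k: "k = Suc (2 * m)"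
      by (elim oddE) simp
    have "(T ^^ k) x = T ((T ^^ (2 * m)) x)"
      by (simp add: k)
    then have "(T ^^ k) x = ((- 1) ^ m * t ^ k) *\<^sub>R N x"
      by (simp only: even) (simp add: T_def scale k mult_ac)
    then show ?thesis
      using k by (simp add: cos_coeff_def sin_coeff_def divide_inverse_commute mult_ac)
  qed
  have "(\<lambda>k. (T ^^ k) x /\<^sub>R fact k) sums (cos t *\<^sub>R x + sin t *\<^sub>R N x)"
    unfolding summand
    by (intro sums_add bounded_linear.sums[OF bounded_linear_scaleR_left] cos_converges sin_converges)
  then show ?thesis
    by (simp add: op_exp_def T_def sums_iff)
qed

text \<open>This is \<open>L_t\<close>, half a circle from \<open>K\<close> through
  \<open>J(A)\<close> to \<open>- K\<close>. Its angle \<open>t * pi\<close> is twice the angle in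
  \<open>beta\<close>, since conjugating by the exponential doubles the angle.\<close>

definition path_structure ::
    "('m::finite cvec \<Rightarrow> 'm cvec \<Rightarrow> complex) \<Rightarrow> 'm dvec set \<Rightarrow> real \<Rightarrow> 'm dvec \<Rightarrow> 'm dvec" where
  "path_structure herm A t x = cos (t * pi) *\<^sub>R op_K x + sin (t * pi) *\<^sub>R J_of herm A x"

context hermitian_double
begin

context
  fixes A :: "'m dvec set"
  assumes A: "dbl.p.subspace A" and KA: "op_K ` A = ortho A"
begin

lemma J_op_K: "J_of herm A (op_K x) = - op_K (J_of herm A x)"
  by (rule anticommute_J_of[OF A op_K_clinear op_K_square KA])

lemma path_structure_skew: "skew_structure herm (path_structure herm A t)"
  unfolding path_structure_def[abs_def]
  by (rule skew_combination[OF op_K_skew J_of_skew[OF A]]) (simp_all add: J_op_K)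

text \<open>The exponential \<open>R \<theta>\<close> is invertible and intertwines \<open>K\<close>
  with \<open>L_t\<close>, so it carries the \<open>\<i>\<close> eigenspace of \<open>K\<close> onto
  that of \<open>L_t\<close>.\<close>

lemma beta_eq_eigenspace: "beta herm t A = eigenspace (path_structure herm A t) \<i>"
proof -
  note K = clinearD[OF op_K_clinear] op_K_square
  note J = clinearD[OF skew_clinear[OF J_of_skew[OF A]]] skew_square[OF J_of_skew[OF A]]
  let ?J = "J_of herm A"
  define \<theta> where "\<theta> = t * pi / 2"
  define R where "R = (\<lambda>\<theta> x. cos \<theta> *\<^sub>R x + sin \<theta> *\<^sub>R op_K (?J x))"
  have beta: "beta herm t A = R \<theta> ` eigenspace op_K \<i>"
    unfolding beta_def R_def \<theta>_def
    \<comment> \<open>Euler's formula applies since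
      \<open>K J K J = - K K J J = - 1\<close>.\<close>
    by (intro image_cong refl op_exp_square_minus_id) (simp_all add: J K J_op_K)
  have R_scale: "R a (c \<cdot> x) = c \<cdot> R a x" for a c x
    by (simp add: R_def J K cscale_simps)
  have R_inverse: "R a (R (- a) x) = x" for a x
  proof -
    have "R a (R (- a) x) = ((cos a)\<^sup>2 + (sin a)\<^sup>2) *\<^sub>R x"
      by (simp add: R_def J K J_op_K power2_eq_square algebra_simps del: sin_cos_squared_add3)
    then show ?thesis
      by simp
  qed
  have L_R: "path_structure herm A t (R \<theta> x) = R \<theta> (op_K x)" for x
  proof -
    \<comment> \<open>With the doubled angle, the subtraction formulas return the cosine and sine of
      \<open>\<theta>\<close> itself.\<close>
    have angle: "t * pi - \<theta> = \<theta>"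
      by (simp add: \<theta>_def)
    have eqs: "cos (t * pi) * cos \<theta> + sin (t * pi) * sin \<theta> = cos \<theta>"
      "sin (t * pi) * cos \<theta> - cos (t * pi) * sin \<theta> = sin \<theta>"
      using cos_diff[of "t * pi" \<theta>] sin_diff[of "t * pi" \<theta>] by (simp_all add: angle)
    have "path_structure herm A t (R \<theta> x) =
      (cos (t * pi) * cos \<theta> + sin (t * pi) * sin \<theta>) *\<^sub>R op_K x
      + (sin (t * pi) * cos \<theta> - cos (t * pi) * sin \<theta>) *\<^sub>R ?J x"
      by (simp add: path_structure_def R_def J K J_op_K algebra_simps)
    also have "\<dots> = R \<theta> (op_K x)"
      unfolding eqs by (simp add: R_def J_op_K J K)
    finally show ?thesis .
  qed
  have "R \<theta> ` eigenspace op_K \<i> = eigenspace (path_structure herm A t) \<i>"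
  proof
    show "R \<theta> ` eigenspace op_K \<i> \<subseteq> eigenspace (path_structure herm A t) \<i>"
      by (auto simp: eigenspace_def L_R R_scale)
    show "eigenspace (path_structure herm A t) \<i> \<subseteq> R \<theta> ` eigenspace op_K \<i>"
    proof
      fix y assume "y \<in> eigenspace (path_structure herm A t) \<i>"
      then have "R \<theta> (op_K (R (- \<theta>) y)) = \<i> \<cdot> y"
        using L_R[of "R (- \<theta>) y"] by (simp add: R_inverse eigenspace_def)
      \<comment> \<open>\<open>\<theta>\<close> is written as \<open>- (- \<theta>)\<close> so that
        \<open>R_inverse\<close> at \<open>- \<theta>\<close> cancels the two rotations.\<close>
      then have "R (- \<theta>) (R (- (- \<theta>)) (op_K (R (- \<theta>) y))) = \<i> \<cdot> R (- \<theta>) y"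
        by (simp add: R_scale)
      then have "R (- \<theta>) y \<in> eigenspace op_K \<i>"
        unfolding R_inverse by (simp add: eigenspace_def)
      then show "y \<in> R \<theta> ` eigenspace op_K \<i>"
        by (metis R_inverse imageI)
    qed
  qed
  then show ?thesis
    by (simp add: beta)
qed

lemma beta_0: "beta herm 0 A = eigenspace op_K \<i>"
  and beta_1: "beta herm 1 A = eigenspace op_K (- \<i>)"
  and beta_half: "beta herm (1 / 2) A = A"
proof -
  show "beta herm 0 A = eigenspace op_K \<i>"
    by (simp add: beta_eq_eigenspace eigenspace_def path_structure_def)
  show "beta herm 1 A = eigenspace op_K (- \<i>)"
    by (simp add: beta_eq_eigenspace eigenspace_def path_structure_def
        minus_equation_iff[of "op_K _"] eq_commute[of "- (\<i> \<cdot> _)"])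
  have "eigenspace (path_structure herm A (1 / 2)) \<i> = eigenspace (J_of herm A) \<i>"
    by (simp add: eigenspace_def path_structure_def)
  then show "beta herm (1 / 2) A = A"
    by (simp add: beta_eq_eigenspace eigenspace_J_of[OF A])
qed

text \<open>\<open>T\<close> anticommutes with \<open>K\<close> by assumption and with
  \<open>J(A)\<close> because it exchanges \<open>A\<close> and its complement; hence it
  anticommutes with every \<open>L_t\<close> and exchanges its eigenspaces. This serves
  \<open>I\<close> and all \<open>J_l\<close> at once.\<close>

lemma image_beta:
  assumes T: "clinear T" "\<And>x. T (T x) = - x"
    and TK: "\<And>x. op_K (T x) = - T (op_K x)" and TA: "T ` A = ortho A"
  shows "T ` beta herm t A = ortho (beta herm t A)"
  unfolding beta_eq_eigenspace ortho_eigenspace[OF path_structure_skew]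
  by (intro image_eigenspace_anticommuting[OF T] skew_clinear[OF path_structure_skew])
    (simp add: path_structure_def TK anticommute_J_of[OF A T TA] clinearD[OF T(1)])

lemma continuous_on_orth_proj_beta:
  "continuous_on S (\<lambda>t. Blinfun (orth_proj herm (beta herm t A)))"
proof -
  let ?J = "J_of herm A"
  have bl: "bounded_linear op_K" "bounded_linear ?J" "bounded_linear (dbl.scale \<i>)"
    using J_of_skew[OF A] by (auto intro!: clinear_imp_bounded_linear op_K_clinear skew_clinear
        simp: clinear_iff cscale_simps)
  note bl' = bounded_linear_compose[OF bl(3) bl(1)] bounded_linear_compose[OF bl(3) bl(2)]
  \<comment> \<open>The projector \<open>(1 - \<i> L_t) / 2\<close> is a combination of three fixed
    bounded operators with coefficients continuous in \<open>t\<close>.\<close>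
  have "Blinfun (orth_proj herm (beta herm t A)) =
      (1 / 2) *\<^sub>R (id_blinfun - cos (t * pi) *\<^sub>R Blinfun (\<lambda>x. \<i> \<cdot> op_K x)
        - sin (t * pi) *\<^sub>R Blinfun (\<lambda>x. \<i> \<cdot> ?J x))" (is "Blinfun ?P = ?B t") for t
  proof -
    have "?P = blinfun_apply (?B t)"
      by (rule ext)
        (simp add: beta_eq_eigenspace orth_proj_eigenspace[OF path_structure_skew] path_structure_def
          blinfun.bilinear_simps bounded_linear_Blinfun_apply[OF bl'(1)]
          bounded_linear_Blinfun_apply[OF bl'(2)] cscale_simps)
    then show ?thesis
      by (simp add: blinfun_apply_inverse)
  qed
  then show ?thesis
    by (simp only:) (intro continuous_intros)
qed

end

end

section \<open>The bilinear form, conjugation and equivariance\<close>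

locale real_double = hermitian_double herm
  for herm :: "'m::finite cvec \<Rightarrow> 'm cvec \<Rightarrow> complex" +
  fixes bil :: "'m cvec \<Rightarrow> 'm cvec \<Rightarrow> complex" and \<gamma> :: "'m cvec \<Rightarrow> 'm cvec"
  assumes bil: "nondegenerate_symmetric_bilinear_form bil"
    and \<gamma>: "antilinear_involution \<gamma>"
    and herm_bil: "herm u v = bil (\<gamma> u) v"
begin

lemma \<gamma>_add: "\<gamma> (u + v) = \<gamma> u + \<gamma> v" and \<gamma>_scale: "\<gamma> (c *s u) = cnj c *s \<gamma> u"
  and \<gamma>_\<gamma>: "\<gamma> (\<gamma> u) = u"
  using \<gamma> unfolding antilinear_involution_def by blast+

lemma bil_commute: "bil v u = bil u v"
  using bil unfolding nondegenerate_symmetric_bilinear_form_def by blast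

definition conjugate :: "'m dvec \<Rightarrow> 'm dvec" where
  "conjugate x = (\<gamma> (fst x), \<gamma> (snd x))"

lemma conjugate_conjugate: "conjugate (conjugate x) = x"
  by (simp add: conjugate_def \<gamma>_\<gamma>)

lemma conjugate_add: "conjugate (x + y) = conjugate x + conjugate y"
  by (simp add: conjugate_def \<gamma>_add)

lemma conjugate_scale: "conjugate (c \<cdot> x) = cnj c \<cdot> conjugate x"
  by (simp add: conjugate_def \<gamma>_scale dbl.scale_def)

lemma conjugate_minus: "conjugate (- x) = - conjugate x"
  using conjugate_scale[of "-1" x] by simp

lemma conjugate_scaleR: "conjugate (r *\<^sub>R x) = r *\<^sub>R conjugate x"
  by (simp add: scaleR_dvec conjugate_scale)

text \<open>Antilinearity turns the entries \<open>\<i>\<close> and \<open>- \<i>\<close> of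
  \<open>K\<close> into their negatives. This sign is the source of the reversal from
  \<open>t\<close> to \<open>1 - t\<close>.\<close>

lemma conjugate_op_K: "conjugate (op_K x) = - op_K (conjugate x)"
  using \<gamma>_scale[of "-1" "\<i> *s snd x"]
  by (simp add: conjugate_def op_K_def \<gamma>_scale flip: vector_sneg_minus1)

text \<open>Both sides are the symmetric bilinear form evaluated at \<open>conjugate x\<close> and
  \<open>conjugate y\<close>.\<close>

lemma h_conjugate_right: "h x (conjugate y) = h y (conjugate x)"
  by (simp add: sum_form_def conjugate_def herm_bil bil_commute[of "\<gamma> _" "\<gamma> _"])

text \<open>Since \<open>\<gamma>\<close> is an involution, pairing \<open>a\<close> with
  \<open>x\<close> bilinearly is the Hermitian pairing of \<open>conjugate x\<close> with
  \<open>a\<close>.\<close>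

lemma complement_bil: "complement_wrt bil S = {x. conjugate x \<in> ortho S}"
proof -
  have "sum_form bil a x = h (conjugate x) a" for a x
    by (simp add: sum_form_def conjugate_def herm_bil \<gamma>_\<gamma> bil_commute[of "fst x"] bil_commute[of "snd x"])
  then show ?thesis
    by (auto simp: complement_wrt_def) (metis complex_cnj_zero h_cnj)+
qed

definition conjugated :: "('m dvec \<Rightarrow> 'm dvec) \<Rightarrow> 'm dvec \<Rightarrow> 'm dvec" where
  "conjugated L x = conjugate (L (conjugate x))"

text \<open>Two antilinear factors compose with \<open>L\<close> to a linear map, and
  \<open>h_conjugate_right\<close> moves the conjugation across the Hermitian product.\<close>

lemma conjugated_skew:
  assumes L: "skew_structure herm L"
  shows "skew_structure herm (conjugated L)"
proof -
  have "h (conjugated L x) y = - h x (conjugated L y)" for x y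
  proof -
    have "h (conjugated L x) y = h (conjugate y) (L (conjugate x))"
      using h_conjugate_right[of "conjugated L x" "conjugate y"] by (simp add: conjugated_def conjugate_conjugate)
    also have "\<dots> = - h (L (conjugate y)) (conjugate x)"
      by (simp add: skew_skew[OF L])
    also have "\<dots> = - h x (conjugated L y)"
      by (simp add: conjugated_def h_conjugate_right[of "L (conjugate y)"])
    finally show ?thesis .
  qed
  then show ?thesis
    unfolding skew_structure_def
    by (simp add: clinear_iff conjugated_def conjugate_conjugate conjugate_add conjugate_scale conjugate_minus
        clinearD[OF skew_clinear[OF L]] skew_square[OF L] del: split_paired_All)
qed

text \<open>The orthogonal complement is the \<open>- \<i>\<close> eigenspace of \<open>L\<close>;
  conjugation turns this eigenvalue back into \<open>\<i>\<close>.\<close>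

lemma complement_bil_eigenspace:
  assumes L: "skew_structure herm L"
  shows "complement_wrt bil (eigenspace L \<i>) = eigenspace (conjugated L) \<i>"
proof -
  have "L (conjugate x) = (- \<i>) \<cdot> conjugate x \<longleftrightarrow> conjugated L x = \<i> \<cdot> x" for x
    using conjugate_conjugate conjugate_scale[of "- \<i>" "conjugate x"] conjugate_scale[of "\<i>" x]
    unfolding conjugated_def by (metis complex_cnj_i complex_cnj_minus minus_minus)
  then show ?thesis
    unfolding complement_bil ortho_eigenspace[OF L] by (simp add: eigenspace_def)
qed

lemma complement_beta:
  assumes A: "dbl.p.subspace A" and KA: "op_K ` A = ortho A"
  shows "complement_wrt bil (beta herm t A) = beta herm (1 - t) (complement_wrt bil A)"
proof -
  let ?J = "J_of herm A" and ?A' = "complement_wrt bil A"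
  note J = J_of_skew[OF A]
  \<comment> \<open>\<open>A\<close> is the \<open>\<i>\<close> eigenspace of \<open>?J\<close>.
    Hence the annihilator has structure \<open>conjugated ?J\<close>, from which both hypotheses of
    \<open>beta_eq_eigenspace\<close> follow for it.\<close>
  have A': "?A' = eigenspace (conjugated ?J) \<i>"
    using complement_bil_eigenspace[OF J] by (simp add: eigenspace_J_of[OF A])
  have anti: "conjugated ?J (op_K x) = - op_K (conjugated ?J x)" for x
    by (simp add: conjugated_def conjugate_op_K clinearD[OF skew_clinear[OF J]] J_op_K[OF A KA] conjugate_minus)
  have "dbl.p.subspace ?A'"
    unfolding A' by (intro subspace_eigenspace skew_clinear conjugated_skew J)
  moreover have "op_K ` ?A' = ortho ?A'"
    unfolding A' ortho_eigenspace[OF conjugated_skew[OF J]]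
    by (intro image_eigenspace_anticommuting op_K_clinear op_K_square anti skew_clinear
        conjugated_skew J)
  ultimately have "beta herm (1 - t) ?A' = eigenspace (path_structure herm ?A' (1 - t)) \<i>"
    by (rule beta_eq_eigenspace)
  also have "path_structure herm ?A' (1 - t) = conjugated (path_structure herm A t)"
  proof
    fix x
    have "J_of herm ?A' = conjugated ?J"
      unfolding A' by (rule J_of_eigenspace[OF conjugated_skew[OF J]])
    \<comment> \<open>Reflecting the angle at \<open>pi / 2\<close> changes only the sign of the
      cosine, which matches the sign that conjugation gives to \<open>K\<close>.\<close>
    moreover have "cos ((1 - t) * pi) = - cos (t * pi)" "sin ((1 - t) * pi) = sin (t * pi)"
      by (simp_all add: left_diff_distrib cos_diff sin_diff)
    ultimately show "path_structure herm ?A' (1 - t) x = conjugated (path_structure herm A t) x"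
      by (simp add: path_structure_def conjugated_def conjugate_add conjugate_scaleR conjugate_op_K conjugate_conjugate)
  qed
  also have "eigenspace \<dots> \<i> = complement_wrt bil (beta herm t A)"
    by (simp add: complement_bil_eigenspace path_structure_skew[OF A KA] beta_eq_eigenspace[OF A KA])
  finally show ?thesis
    by simp
qed

end

theorem lemma4p6:
  fixes herm bil :: "complex ^ 'm \<Rightarrow> complex ^ 'm \<Rightarrow> complex"
    and \<gamma> :: "complex ^ 'm \<Rightarrow> complex ^ 'm"
    and j :: "nat \<Rightarrow> complex ^ 'm \<Rightarrow> complex ^ 'm"
    and n s :: nat
    and A :: "((complex ^ 'm) \<times> (complex ^ 'm)) set"
  assumes "CARD('m) = 2 * n"
    and "hermitian_product herm"
    and "nondegenerate_symmetric_bilinear_form bil"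
    and "antilinear_involution \<gamma>"
    and "\<And>u v. herm u v = bil (\<gamma> u) v"
    and "clifford_generators s j"
    and "\<And>l. l \<in> {1..s} \<Longrightarrow> preserves_form herm (j l)"
    and "\<And>l. l \<in> {1..s} \<Longrightarrow> preserves_form bil (j l)"
    and "A \<in> C_second herm s j"
  shows "pathin (subtopology (subspace_topology herm) (C_first herm s j)) (\<lambda>t. beta herm t A)
    \<and> beta herm 0 A = eigenspace op_K \<i>
    \<and> beta herm 1 A = eigenspace op_K (- \<i>)
    \<and> beta herm (1 / 2) A = A
    \<and> (\<forall>t\<in>{0..1}. complement_wrt bil (beta herm t A) = beta herm (1 - t) (complement_wrt bil A))"
proof -
  interpret real_double herm bil \<gamma>
    using assms(2-5) by unfold_locales
  note j = assms(6)
  have A: "dbl.p.subspace A" and KA: "op_K ` A = ortho A" and IA: "op_I ` A = ortho A"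
    and JA: "\<And>l. l \<in> {1..s} \<Longrightarrow> op_J j l ` A = ortho A"
    using assms(9) by (simp_all add: C_second_def C_first_def)
  have subspace: "dbl.p.subspace (beta herm t A)" for t
    unfolding beta_eq_eigenspace[OF A KA]
    by (intro subspace_eigenspace skew_clinear path_structure_skew A KA)
  have "beta herm t A \<in> C_first herm s j" for t
    unfolding C_first_def
    using subspace image_beta[OF A KA op_I_clinear op_I_square op_K_op_I IA]
      image_beta[OF A KA op_J_clinear[OF j] op_J_square[OF j] op_K_op_J[OF j] JA]
    by blast
  \<comment> \<open>In the pullback topology continuity means that every value is a subspace and
    that the projectors vary continuously.\<close>
  moreover have "continuous_map (top_of_set {0..1}) (subspace_topology herm) (\<lambda>t. beta herm t A)"
    unfolding subspace_topology_def
    by (intro continuous_map_pullback')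
      (auto simp: o_def subspace continuous_on_orth_proj_beta[OF A KA])
  ultimately have "pathin (subtopology (subspace_topology herm) (C_first herm s j)) (\<lambda>t. beta herm t A)"
    by (simp add: pathin_def continuous_map_in_subtopology)
  then show ?thesis
    using beta_0[OF A KA] beta_1[OF A KA] beta_half[OF A KA] complement_beta[OF A KA] by blast
qed

end
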